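(* Let $\mathcal{G}_1$ and $\mathcal{G}_2$ be graphs with common vertex set $\{1,\dots,p\}$ such that $\mathcal{G}_1\subset\mathcal{G}_2$, i.e. $E(\mathcal{G}_1)\subseteq E(\mathcal{G}_2)$. Then $\rho(\mathcal{G}_1) \leq \rho(\mathcal{G}_2)$ and $\rho^*(\mathcal{G}_1) \leq \rho^*(\mathcal{G}_2)$.
   Context: Graphs are finite, simple and undirected, $\mathcal{G}=(V,E)$ with $V=\{1,\dots,p\}$, $p\ge 1$, and $E=E(\mathcal{G})\subseteq\{\{i,j\}: i,j\in V,\ i\neq j\}$. $\mathcal{S}$ is the space of real symmetric $p\times p$ matrices. $\mathcal{S}_{\mathcal{G}}=\{\Omega\in\mathcal{S}: \Omega_{ij}=0 \text{ for all } i\neq j \text{ with } \{i,j\}\notin E\}$ (diagonal entries are unconstrained). $\mathcal{D}_{\mathcal{G}}^{++}=\{\Omega\in\mathcal{S}_{\mathcal{G}}:\Omega_{ii}>0\ \forall i\}$. For a positive semidefinite $A\in\mathcal{S}$ and $\Omega\in\mathcal{D}_{\mathcal{G}}^{++}$ with columns $\Omega_{\cdot 1},\dots,\Omega_{\cdot p}$, the CONCORD objective is $C_A(\Omega)=-2\sum_{i=1}^p\log\Omega_{ii}+\sum_{i=1}^p\Omega_{\cdot i}^{\top}A\,\Omega_{\cdot i}$, and the CONSPACE objective is $H_A(\Omega)=-2\sum_{i=1}^p\log\Omega_{ii}+\sum_{i=1}^p\Omega_{ii}^{-1}\Omega_{\cdot i}^{\top}A\,\Omega_{\cdot i}$. A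 symmetric matrix $A$ is in general position if every $q\times q$ principal submatrix of $A$ has rank $\min\{q,\operatorname{rank}(A)\}$. "For almost every $A\succeq 0$ with $\operatorname{rank}(A)\ge\rho$" means: for each integer $r$ with $\rho\le r\le p$, the property holds for $A=X^\top X$ for Lebesgue-almost every $X\in\mathbb{R}^{r\times p}$. Weak pseudo-likelihood rank $\rho(\mathcal{G})$: the smallest $\rho\in\mathbb{N}$ such that a unique minimizer of $C_A$ exists on $\mathcal{D}_{\mathcal{G}}^{++}$ for almost every $A\succeq 0$ with $\operatorname{rank}(A)\ge\rho$. Strong pseudo-likelihood rank $\rho^*(\mathcal{G})$: the smallest $\rho^*\in\mathbb{N}$ such that a unique minimizer of $C_A$ exists on $\mathcal{D}_{\mathcal{G}}^{++}$ for every $A\succeq0$ in general position with $\operatorname{rank}(A)\ge\rho^*$. (Using $H_A$ in place of $C_A$ gives the same numbers.) *)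

theory Defs
  imports "HOL-Analysis.Analysis"
begin

(* The vertex set {1..p}, p >= 1, is the finite (nonempty) index type 'n, with p = CARD('n).
   A graph on it is given by its set of edges, which are two-element sets of vertices. *)

definition graph_edges :: "'n set set \<Rightarrow> bool" where
  "graph_edges E \<longleftrightarrow> E \<subseteq> {{i, j} | i j. i \<noteq> j}"

definition sym_mat :: "real^'n^'n \<Rightarrow> bool" where
  "sym_mat A \<longleftrightarrow> transpose A = A"

definition psd_mat :: "real^'n^'n \<Rightarrow> bool" where
  "psd_mat A \<longleftrightarrow> sym_mat A \<and> (\<forall>x. 0 \<le> x \<bullet> (A *v x))"

definition graph_mats :: "'n set set \<Rightarrow> (real^'n^'n) set" where
  "graph_mats E = {\<Omega>. sym_mat \<Omega> \<and> (\<forall>i j. i \<noteq> j \<and> {i, j} \<notin> E \<longrightarrow> \<Omega> $ i $ j = 0)}"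

definition graph_mats_pos_diag :: "'n set set \<Rightarrow> (real^'n^'n) set" where
  "graph_mats_pos_diag E = {\<Omega> \<in> graph_mats E. \<forall>i. \<Omega> $ i $ i > 0}"

definition concord :: "real^'n^'n \<Rightarrow> real^'n^'n \<Rightarrow> real" where
  "concord A \<Omega> = - 2 * (\<Sum>i\<in>UNIV. ln (\<Omega> $ i $ i))
     + (\<Sum>i\<in>UNIV. column i \<Omega> \<bullet> (A *v column i \<Omega>))"

definition concord_unique_minimizer :: "'n set set \<Rightarrow> real^'n^'n \<Rightarrow> bool" where
  "concord_unique_minimizer E A \<longleftrightarrow>
     (\<exists>!\<Omega>. is_arg_min (concord A) (\<lambda>\<Omega>. \<Omega> \<in> graph_mats_pos_diag E) \<Omega>)"

(* The principal submatrix with index set Q, padded by zero rows and columns to full size,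
   since the size of a matrix is part of its type. Padding does not change the rank. *)

definition principal_submat :: "real^'n^'n \<Rightarrow> 'n set \<Rightarrow> real^'n^'n" where
  "principal_submat A Q = (\<chi> i j. if i \<in> Q \<and> j \<in> Q then A $ i $ j else 0)"

definition general_position :: "real^'n^'n \<Rightarrow> bool" where
  "general_position A \<longleftrightarrow>
     sym_mat A \<and> (\<forall>Q. rank (principal_submat A Q) = min (card Q) (rank A))"

(* An r x p matrix X is represented by its rows X 0, ..., X (r - 1); gram r X is X^T X. *)

definition gram :: "nat \<Rightarrow> (nat \<Rightarrow> real^'n) \<Rightarrow> real^'n^'n" where
  "gram r X = (\<chi> j k. \<Sum>i<r. X i $ j * X i $ k)"

(* The product of r copies of lborel is r x p-dimensional Lebesgue measure on the Borel sets.
   AE only asks for the exceptional set to be contained in a null set, so completing the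
   measure would make no difference. *)

definition almost_every_psd_rank_ge :: "nat \<Rightarrow> (real^'n^'n \<Rightarrow> bool) \<Rightarrow> bool" where
  "almost_every_psd_rank_ge \<rho> P \<longleftrightarrow>
     (\<forall>r. \<rho> \<le> r \<and> r \<le> CARD('n) \<longrightarrow>
       (AE X in Pi\<^sub>M {..<r} (\<lambda>_. lborel :: (real^'n) measure). P (gram r X)))"

(* Both sets of admissible values below contain p + 1 (vacuously), so LEAST is a minimum. *)

definition weak_pl_rank :: "'n::finite set set \<Rightarrow> nat" where
  "weak_pl_rank E = (LEAST \<rho>. almost_every_psd_rank_ge \<rho> (concord_unique_minimizer E))"

definition strong_pl_rank :: "'n::finite set set \<Rightarrow> nat" where
  "strong_pl_rank E = (LEAST \<rho>. \<forall>A. psd_mat A \<and> general_position A \<and> rank A \<ge> \<rho>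
     \<longrightarrow> concord_unique_minimizer E A)"

end

(* For positive semidefinite A, the CONCORD objective is a convex function whose recession
   directions in the space of E are the matrices D of that space with A D = 0 and nonnegative
   diagonal. A unique minimizer exists if and only if D = 0 is the only such direction: adding a
   direction to a minimizer gives another minimizer, and conversely without a direction the
   quadratic part dominates a multiple of the squared norm, so that the objective is coercive,
   while two minimizers have the same diagonal and differ by a direction. The criterion gets
   weaker when edges are removed, for each A separately, so both ranks are monotone. *)

theory Submission
  imports Defs
begin

section \<open>The quadratic part of the objective and its kernel\<close>

definition quad_part :: "real^'n^'n \<Rightarrow> real^'n^'n \<Rightarrow> real" where
  "quad_part A \<Omega> = (\<Sum>i\<in>UNIV. column i \<Omega> \<bullet> (A *v column i \<Omega>))"

text \<open>The sign condition is weak, so that the candidate directions form a closed cone, as the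
  compactness argument for the lower bound requires.\<close>

definition no_recession :: "'n set set \<Rightarrow> real^'n^'n \<Rightarrow> bool" where
  "no_recession E A \<longleftrightarrow>
     (\<forall>D\<in>graph_mats E. (\<forall>i. A *v column i D = 0) \<and> (\<forall>i. 0 \<le> D $ i $ i) \<longrightarrow> D = 0)"

lemma concord_eq: "concord A \<Omega> = quad_part A \<Omega> - (\<Sum>i\<in>UNIV. 2 * ln (\<Omega> $ i $ i))"
  by (simp add: concord_def quad_part_def sum_distrib_left sum_negf)

lemma column_add: "column i (X + Y) = column i X + column i Y"
  and column_diff: "column i (X - Y) = column i X - column i Y"
  and column_scaleR: "column i (c *\<^sub>R X) = c *\<^sub>R column i X"
  for X Y :: "real^'n^'m"
  by (simp_all add: column_def vec_eq_iff)

lemma sym_mat_inner: "x \<bullet> (A *v y) = y \<bullet> (A *v x)" if "sym_mat A"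
  using that by (metis dot_lmul_matrix inner_commute sym_mat_def vector_transpose_matrix)

lemma sym_mat_nth: "sym_mat A \<longleftrightarrow> (\<forall>i j. A $ i $ j = A $ j $ i)"
  unfolding sym_mat_def transpose_def vec_eq_iff by auto

text \<open>If \<open>y = A *v x\<close> were nonzero, a small step from \<open>x\<close> along
  \<open>-y\<close> would make the form negative: the linear term beats the quadratic one.\<close>

lemma psd_mat_kernel:
  assumes "psd_mat A" and "x \<bullet> (A *v x) = 0"
  shows "A *v x = 0"
proof (rule ccontr)
  define y where "y = A *v x"
  define m where "m = y \<bullet> (A *v y)"
  \<comment> \<open>The summand 1 keeps the denominator positive when \<open>m = 0\<close> and still
    gives \<open>s * m\<close> \<le> \<open>s * (m + 1)\<close>, which is the squared norm of
    \<open>y\<close>.\<close>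
  define s where "s = (y \<bullet> y) / (m + 1)"
  assume "A *v x \<noteq> 0"
  then have y: "0 < y \<bullet> y" by (simp add: y_def)
  have m: "0 \<le> m" using assms(1) by (simp add: psd_mat_def m_def)
  have s: "0 < s" using y m by (simp add: s_def)
  have "x \<bullet> (A *v y) = y \<bullet> y"
    using sym_mat_inner[of A x y] assms(1) by (simp add: psd_mat_def y_def)
  then have "(x - s *\<^sub>R y) \<bullet> (A *v (x - s *\<^sub>R y)) = s * (s * m - 2 * (y \<bullet> y))"
    using assms(2)
    by (simp add: matrix_vector_mult_diff_distrib matrix_vector_mult_scaleR inner_diff_left
        inner_diff_right m_def y_def[symmetric] algebra_simps)
  moreover have "0 \<le> (x - s *\<^sub>R y) \<bullet> (A *v (x - s *\<^sub>R y))"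
    using assms(1) by (simp add: psd_mat_def)
  ultimately have "2 * (y \<bullet> y) \<le> s * m"
    using s by (simp add: zero_le_mult_iff)
  also have "s * m \<le> s * (m + 1)" using s by simp
  also have "s * (m + 1) = y \<bullet> y" using m by (simp add: s_def)
  finally show False using y by simp
qed

lemma quad_part_nonneg: "0 \<le> quad_part A \<Omega>" if "psd_mat A"
  using that by (auto simp: quad_part_def psd_mat_def intro: sum_nonneg)

lemma quad_part_eq_0_iff:
  assumes "psd_mat A"
  shows "quad_part A D = 0 \<longleftrightarrow> (\<forall>i. A *v column i D = 0)"
proof
  assume "quad_part A D = 0"
  then have "column i D \<bullet> (A *v column i D) = 0" for i
    using assms unfolding quad_part_def
    by (subst (asm) sum_nonneg_eq_0_iff) (auto simp: psd_mat_def)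
  then show "\<forall>i. A *v column i D = 0"
    using psd_mat_kernel[OF assms] by blast
qed (simp add: quad_part_def)

lemma quad_part_scaleR: "quad_part A (c *\<^sub>R \<Omega>) = c\<^sup>2 * quad_part A \<Omega>"
  by (simp add: quad_part_def column_scaleR matrix_vector_mult_scaleR sum_distrib_left
      power2_eq_square mult.assoc)

lemma quad_part_parallelogram:
  "quad_part A (X + Y) + quad_part A (X - Y) = 2 * quad_part A X + 2 * quad_part A Y"
  by (simp add: quad_part_def column_add column_diff matrix_vector_right_distrib
      matrix_vector_mult_diff_distrib inner_add_left inner_add_right inner_diff_left
      inner_diff_right sum_distrib_left flip: sum.distrib)

text \<open>Symmetry moves \<open>A\<close> onto the column of \<open>D\<close> in the cross terms,
  where it gives zero.\<close>

lemma quad_part_add_kernel: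
  assumes "sym_mat A" and "\<And>i. A *v column i D = 0"
  shows "quad_part A (\<Omega> + D) = quad_part A \<Omega>"
proof -
  have "column i D \<bullet> (A *v column i \<Omega>) = 0" for i
    using sym_mat_inner[OF assms(1)] assms(2) by (metis inner_zero_right)
  then show ?thesis
    by (simp add: quad_part_def column_add matrix_vector_right_distrib inner_add_left assms(2))
qed

lemma continuous_on_quad_part: "continuous_on S (quad_part A)"
  unfolding quad_part_def column_def matrix_vector_mult_def inner_vec_def
  by (auto intro!: continuous_intros)

section \<open>The linear space of matrices belonging to a graph\<close>

lemma graph_mats_add: "X + Y \<in> graph_mats E"
  and graph_mats_diff: "X - Y \<in> graph_mats E"
  if "X \<in> graph_mats E" "Y \<in> graph_mats E"
  using that by (auto simp: graph_mats_def sym_mat_nth)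

lemma graph_mats_scaleR: "c *\<^sub>R X \<in> graph_mats E" if "X \<in> graph_mats E"
  using that by (auto simp: graph_mats_def sym_mat_nth)

lemma closed_graph_mats: "closed (graph_mats E)"
proof -
  have "graph_mats E = (\<Inter>i j. {X. X $ i $ j = X $ j $ i}) \<inter>
      (\<Inter>i j. {X. i \<noteq> j \<and> {i, j} \<notin> E \<longrightarrow> X $ i $ j = 0})"
    by (auto simp: graph_mats_def sym_mat_nth)
  moreover have "closed {X :: real^'n^'n. X $ i $ j = X $ j $ i}" for i j
    by (intro closed_Collect_eq continuous_intros)
  moreover have "closed {X :: real^'n^'n. P \<longrightarrow> X $ i $ j = 0}" for P i j
    by (cases P) (auto intro!: closed_Collect_eq continuous_intros)
  ultimately show ?thesis
    by (auto intro!: closed_INT closed_Int)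
qed

lemma closed_diag_ge: "closed {X :: real^'n^'n. \<forall>i. e \<le> X $ i $ i}"
  by (intro closed_Collect_all closed_Collect_le continuous_intros)

text \<open>The identity serves as a reference point: it shows that the compact sets below are
  nonempty and supplies the level of the sublevel set.\<close>

lemma mat_1_in_graph_mats_pos_diag: "mat 1 \<in> graph_mats_pos_diag E"
  by (auto simp: graph_mats_pos_diag_def graph_mats_def sym_mat_def transpose_mat)
     (auto simp: mat_def)

section \<open>Coercivity and existence of a minimizer\<close>

lemma sum_diag_sq_le: "(\<Sum>i\<in>UNIV. (\<Omega> $ i $ i)\<^sup>2) \<le> (norm \<Omega>)\<^sup>2" for \<Omega> :: "real^'n^'n"
proof -
  have "(\<Omega> $ i $ i)\<^sup>2 \<le> (norm (\<Omega> $ i))\<^sup>2" for i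
    using power_mono[OF component_le_norm_cart[of "\<Omega> $ i" i], of 2] by simp
  then have "(\<Sum>i\<in>UNIV. (\<Omega> $ i $ i)\<^sup>2) \<le> (\<Sum>i\<in>UNIV. (norm (\<Omega> $ i))\<^sup>2)"
    by (intro sum_mono)
  also have "\<dots> = (norm \<Omega>)\<^sup>2"
    by (simp add: norm_vec_def L2_set_def sum_nonneg)
  finally show ?thesis .
qed

text \<open>By homogeneity of degree two it suffices to bound the quadratic part on the unit sphere.
  Its minimum over the compact set \<open>K\<close> is positive, since a zero would be a recession
  direction of norm 1.\<close>

lemma quad_part_lower_bound:
  fixes A :: "real^'n^'n"
  assumes "psd_mat A" and "no_recession E A"
  obtains c where "0 < c"
    and "\<And>\<Omega>. \<Omega> \<in> graph_mats_pos_diag E \<Longrightarrow> c * (norm \<Omega>)\<^sup>2 \<le> quad_part A \<Omega>"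
proof -
  define K where "K = graph_mats E \<inter> {X :: real^'n^'n. \<forall>i. 0 \<le> X $ i $ i} \<inter> sphere 0 1"
  have K: "(1 / norm \<Omega>) *\<^sub>R \<Omega> \<in> K" "\<Omega> \<noteq> 0" if "\<Omega> \<in> graph_mats_pos_diag E" for \<Omega>
  proof -
    show nz: "\<Omega> \<noteq> 0"
      using that by (auto simp: graph_mats_pos_diag_def)
    show "(1 / norm \<Omega>) *\<^sub>R \<Omega> \<in> K"
      using that nz graph_mats_scaleR[of \<Omega> E "1 / norm \<Omega>"]
      by (auto simp: K_def graph_mats_pos_diag_def less_imp_le)
  qed
  have "compact K"
    unfolding K_def by (intro closed_Int_compact closed_Int closed_graph_mats closed_diag_ge compact_sphere)
  moreover have "K \<noteq> {}"
    using K(1)[OF mat_1_in_graph_mats_pos_diag] by blast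
  ultimately obtain X where X: "X \<in> K" "\<And>Y. Y \<in> K \<Longrightarrow> quad_part A X \<le> quad_part A Y"
    using continuous_attains_inf[OF _ _ continuous_on_quad_part] by metis
  have "quad_part A X \<noteq> 0"
  proof
    assume "quad_part A X = 0"
    then have "X = 0"
      using assms X(1) by (auto simp: quad_part_eq_0_iff no_recession_def K_def)
    then show False using X(1) by (simp add: K_def)
  qed
  then have "0 < quad_part A X"
    using quad_part_nonneg[OF assms(1), of X] by simp
  moreover have "quad_part A X * (norm \<Omega>)\<^sup>2 \<le> quad_part A \<Omega>"
    if "\<Omega> \<in> graph_mats_pos_diag E" for \<Omega>
    using X(2)[OF K(1)[OF that]] K(2)[OF that]
    by (simp add: quad_part_scaleR power_divide field_simps)
  ultimately show thesis using that by blast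
qed

text \<open>Half of the quadratic lower bound absorbs the logarithms, the other half bounds the
  norm. The sublevel set of the identity thus lies in a compact set whose diagonals stay away from
  0, where the objective is continuous.\<close>

lemma minimizer_exists:
  fixes A :: "real^'n^'n"
  assumes "psd_mat A" and "no_recession E A"
  shows "\<exists>\<Omega>. is_arg_min (concord A) (\<lambda>\<Omega>. \<Omega> \<in> graph_mats_pos_diag E) \<Omega>"
proof -
  obtain c where c: "0 < c"
    and Q: "\<And>\<Omega>. \<Omega> \<in> graph_mats_pos_diag E \<Longrightarrow> c * (norm \<Omega>)\<^sup>2 \<le> quad_part A \<Omega>"
    using quad_part_lower_bound[OF assms] by blast
  \<comment> \<open>This constant comes from \<open>ln u\<close> \<le> \<open>u - 1\<close> at
    \<open>u = c / 2 * t\<^sup>2\<close>; see \<open>log_bound\<close>.\<close>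
  define k where "k = 1 + ln (c / 2)"
  define M where "M = concord A (mat 1)"
  define p where "p = real (CARD('n))"
  \<comment> \<open>The summand 1 ensures \<open>R\<close> \<le> \<open>R\<^sup>2\<close>, so a
    bound on the squared norm yields one on the norm without a square root.\<close>
  define R where "R = 1 + 2 * \<bar>M - p * k\<bar> / c"
  \<comment> \<open>Obtained by solving \<open>- k - 2 * ln t\<close> \<le> \<open>M - p * k\<close>
    for \<open>t\<close>.\<close>
  define e where "e = exp (((p - 1) * k - M) / 2)"
  have log_bound: "2 * ln t \<le> c / 2 * t\<^sup>2 - k" if "0 < t" for t
  proof -
    have "ln (c / 2 * t\<^sup>2) \<le> c / 2 * t\<^sup>2 - 1"
      using c that by (intro ln_le_minus_one) auto
    moreover have "ln (c / 2 * t\<^sup>2) = ln (c / 2) + 2 * ln t"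
      using c that by (subst ln_mult) (auto simp: ln_realpow)
    ultimately show ?thesis by (simp add: k_def)
  qed
  have bounds: "norm \<Omega> \<le> R" "\<And>i. e \<le> \<Omega> $ i $ i"
    if \<Omega>: "\<Omega> \<in> graph_mats_pos_diag E" and le: "concord A \<Omega> \<le> M" for \<Omega>
  proof -
    \<comment> \<open>The slack in \<open>log_bound\<close> at the i-th diagonal entry. All slacks
      are nonnegative, so a bound on their sum bounds each one.\<close>
    define g where "g i = c / 2 * (\<Omega> $ i $ i)\<^sup>2 - k - 2 * ln (\<Omega> $ i $ i)" for i
    have pos: "0 < \<Omega> $ i $ i" for i
      using \<Omega> by (simp add: graph_mats_pos_diag_def)
    have g: "0 \<le> g i" for i
      using log_bound[OF pos[of i]] by (simp add: g_def)
    have "(\<Sum>i\<in>UNIV. g i) =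
        c / 2 * (\<Sum>i\<in>UNIV. (\<Omega> $ i $ i)\<^sup>2) - p * k - (\<Sum>i\<in>UNIV. 2 * ln (\<Omega> $ i $ i))"
      by (simp add: g_def sum_subtractf sum_distrib_left p_def)
    moreover have "c / 2 * (\<Sum>i\<in>UNIV. (\<Omega> $ i $ i)\<^sup>2) \<le> c / 2 * (norm \<Omega>)\<^sup>2"
      using c sum_diag_sq_le[of \<Omega>] by (intro mult_left_mono) auto
    ultimately have sum_g: "(\<Sum>i\<in>UNIV. g i) + c / 2 * (norm \<Omega>)\<^sup>2 \<le> M - p * k"
      using Q[OF \<Omega>] le by (simp add: concord_eq)
    have "0 \<le> (\<Sum>i\<in>UNIV. g i)"
      using g by (simp add: sum_nonneg)
    then have "c / 2 * (norm \<Omega>)\<^sup>2 \<le> \<bar>M - p * k\<bar>"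
      using sum_g by linarith
    then have "(norm \<Omega>)\<^sup>2 \<le> 2 * \<bar>M - p * k\<bar> / c"
      using c by (simp add: field_simps)
    also have "\<dots> \<le> R"
      by (simp add: R_def)
    also have "R \<le> R\<^sup>2"
      using c by (intro self_le_power) (simp_all add: R_def)
    finally show "norm \<Omega> \<le> R"
      by (rule power2_le_imp_le) (use c in \<open>simp add: R_def\<close>)
    fix i
    have "g i \<le> (\<Sum>i\<in>UNIV. g i)"
      using g by (intro member_le_sum) auto
    moreover have "c / 2 * (\<Omega> $ i $ i)\<^sup>2 \<ge> 0" "c / 2 * (norm \<Omega>)\<^sup>2 \<ge> 0"
      using c by simp_all
    ultimately have "((p - 1) * k - M) / 2 \<le> ln (\<Omega> $ i $ i)"
      using sum_g by (simp add: g_def algebra_simps)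
    then show "e \<le> \<Omega> $ i $ i"
      unfolding e_def using pos[of i] by (simp only: ln_ge_iff)
  qed
  define S where "S = graph_mats E \<inter> {X :: real^'n^'n. \<forall>i. e \<le> X $ i $ i} \<inter> cball 0 R"
  have e: "0 < e" by (simp add: e_def)
  have S_pos: "\<Omega> \<in> graph_mats_pos_diag E" if "\<Omega> \<in> S" for \<Omega>
    using that less_le_trans[OF e] by (auto simp: S_def graph_mats_pos_diag_def)
  have S: "\<Omega> \<in> S" if "\<Omega> \<in> graph_mats_pos_diag E" "concord A \<Omega> \<le> M" for \<Omega>
    using bounds[OF that] that(1) by (auto simp: S_def graph_mats_pos_diag_def)
  have "compact S"
    unfolding S_def by (intro closed_Int_compact closed_Int closed_graph_mats closed_diag_ge compact_cball)
  moreover have one: "mat 1 \<in> S"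
    using S[OF mat_1_in_graph_mats_pos_diag] by (simp add: M_def)
  moreover have "continuous_on S (concord A)"
  proof -
    have "X $ i $ i \<noteq> 0" if "X \<in> S" for X i
      using S_pos[OF that] by (simp add: graph_mats_pos_diag_def less_imp_neq[THEN not_sym])
    then show ?thesis
      unfolding concord_eq by (intro continuous_intros continuous_on_quad_part) auto
  qed
  ultimately obtain X where X: "X \<in> S" "\<And>Y. Y \<in> S \<Longrightarrow> concord A X \<le> concord A Y"
    using continuous_attains_inf[of S "concord A"] by blast
  \<comment> \<open>A competitor in the sublevel set lies in \<open>S\<close>; any other has a value
    above \<open>M\<close>, which is attained at the identity in \<open>S\<close>.\<close>
  have "concord A X \<le> concord A Y" if "Y \<in> graph_mats_pos_diag E" for Y
    using X(2)[OF one] X(2)[OF S[OF that]] unfolding M_def by linarith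
  then show ?thesis
    using S_pos[OF X(1)] by (auto simp: is_arg_min_def not_less)
qed

section \<open>Uniqueness of the minimizer\<close>

text \<open>This is the inequality of arithmetic and geometric means under the logarithm; the gap
  \<open>((a - b) / 2)\<^sup>2\<close> also settles equality.\<close>

lemma ln_midpoint:
  fixes a b :: real
  assumes "0 < a" and "0 < b"
  shows "ln a + ln b \<le> 2 * ln ((a + b) / 2)"
    and "ln a + ln b = 2 * ln ((a + b) / 2) \<longleftrightarrow> a = b"
proof -
  have eq: "ln a + ln b = ln (a * b)" "2 * ln ((a + b) / 2) = ln (((a + b) / 2)\<^sup>2)"
    using assms by (simp_all add: ln_mult ln_realpow)
  have sq: "((a + b) / 2)\<^sup>2 - a * b = ((a - b) / 2)\<^sup>2"
    by (simp add: power2_eq_square field_simps)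
  show "ln a + ln b \<le> 2 * ln ((a + b) / 2)"
  proof -
    have "a * b \<le> ((a + b) / 2)\<^sup>2"
      using sq zero_le_power2[of "(a - b) / 2"] by linarith
    then show ?thesis
      unfolding eq using assms by (subst ln_le_cancel_iff) auto
  qed
  have "ln (a * b) = ln (((a + b) / 2)\<^sup>2) \<longleftrightarrow> a * b = ((a + b) / 2)\<^sup>2"
    using assms by (intro ln_inj_iff) auto
  also have "\<dots> \<longleftrightarrow> ((a - b) / 2)\<^sup>2 = 0"
    using sq by auto
  finally show "ln a + ln b = 2 * ln ((a + b) / 2) \<longleftrightarrow> a = b"
    unfolding eq by simp
qed

text \<open>Two minimizers are compared with their midpoint \<open>Z\<close>. The convexity gaps of
  the logarithms and of the quadratic part are nonnegative, so optimality forces both to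
  vanish.\<close>

lemma minimizer_unique:
  fixes A :: "real^'n^'n"
  assumes "psd_mat A" and "no_recession E A"
    and X: "is_arg_min (concord A) (\<lambda>\<Omega>. \<Omega> \<in> graph_mats_pos_diag E) X"
    and Y: "is_arg_min (concord A) (\<lambda>\<Omega>. \<Omega> \<in> graph_mats_pos_diag E) Y"
  shows "X = Y"
proof -
  define Z where "Z = (1 / 2) *\<^sub>R (X + Y)"
  define h where "h i = 2 * ln (Z $ i $ i) - (ln (X $ i $ i) + ln (Y $ i $ i))" for i
  have mem: "X \<in> graph_mats E" "Y \<in> graph_mats E"
    and pos: "\<And>i. 0 < X $ i $ i" "\<And>i. 0 < Y $ i $ i"
    using X Y by (auto simp: is_arg_min_def graph_mats_pos_diag_def)
  have Z: "Z $ i $ i = (X $ i $ i + Y $ i $ i) / 2" for i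
    by (simp add: Z_def)
  have "Z \<in> graph_mats_pos_diag E"
    using mem pos graph_mats_scaleR[OF graph_mats_add[OF mem], of "1 / 2"]
    by (simp add: graph_mats_pos_diag_def Z add_pos_pos) (simp add: Z_def)
  then have "concord A X \<le> concord A Z" "concord A Y \<le> concord A Z"
    using X Y by (auto simp: is_arg_min_def not_less)
  moreover have "quad_part A Z = (1 / 4) * quad_part A (X + Y)"
    by (simp add: Z_def quad_part_scaleR power2_eq_square)
  moreover have "(\<Sum>i\<in>UNIV. h i) = (\<Sum>i\<in>UNIV. 2 * ln (Z $ i $ i))
      - ((\<Sum>i\<in>UNIV. ln (X $ i $ i)) + (\<Sum>i\<in>UNIV. ln (Y $ i $ i)))"
    by (simp add: h_def sum_subtractf sum.distrib)
  \<comment> \<open>Both comparisons with \<open>Z\<close> are added; the parallelogram law turns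
    the quadratic terms into \<open>quad_part A (X - Y) / 2\<close>.\<close>
  ultimately have le: "2 * (\<Sum>i\<in>UNIV. h i) + quad_part A (X - Y) / 2 \<le> 0"
    using quad_part_parallelogram[of A X Y]
    by (simp add: concord_eq flip: sum_distrib_left)
  have h: "0 \<le> h i" for i
    using ln_midpoint(1)[OF pos] by (simp add: h_def Z)
  have "0 \<le> (\<Sum>i\<in>UNIV. h i)"
    using h by (simp add: sum_nonneg)
  then have "(\<Sum>i\<in>UNIV. h i) = 0" and ker: "quad_part A (X - Y) = 0"
    using le quad_part_nonneg[OF assms(1), of "X - Y"] by auto
  then have "h i = 0" for i
    using h by (simp add: sum_nonneg_eq_0_iff)
  \<comment> \<open>The diagonals agree, so that of \<open>X - Y\<close> is zero and
    \<open>X - Y\<close> qualifies as a recession direction.\<close>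
  then have "0 \<le> (X - Y) $ i $ i" for i
    using ln_midpoint(2)[OF pos, of i i] by (simp add: h_def Z)
  moreover have "\<forall>i. A *v column i (X - Y) = 0"
    using ker quad_part_eq_0_iff[OF assms(1)] by blast
  ultimately have "X - Y = 0"
    using assms(2) graph_mats_diff[OF mem] unfolding no_recession_def by blast
  then show ?thesis by simp
qed

section \<open>The criterion and its dependence on the edge set\<close>

text \<open>Adding a recession direction to a minimizer keeps the quadratic part and does not
  decrease the diagonal, so the sum is a minimizer too.\<close>

lemma unique_minimizer_no_recession:
  assumes "psd_mat A" and "concord_unique_minimizer E A"
  shows "no_recession E A"
  unfolding no_recession_def
proof (intro ballI impI, elim conjE)
  fix D
  assume D: "D \<in> graph_mats E" "\<forall>i. A *v column i D = 0" "\<forall>i. 0 \<le> D $ i $ i"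
  obtain X where X: "is_arg_min (concord A) (\<lambda>\<Omega>. \<Omega> \<in> graph_mats_pos_diag E) X"
    and uniq: "\<And>Y. is_arg_min (concord A) (\<lambda>\<Omega>. \<Omega> \<in> graph_mats_pos_diag E) Y \<Longrightarrow> Y = X"
    using assms(2) by (auto simp: concord_unique_minimizer_def)
  have pos: "0 < X $ i $ i" and mem: "X \<in> graph_mats E" for i
    using X by (auto simp: is_arg_min_def graph_mats_pos_diag_def)
  have "(\<Sum>i\<in>UNIV. 2 * ln (X $ i $ i)) \<le> (\<Sum>i\<in>UNIV. 2 * ln ((X + D) $ i $ i))"
    using pos D(3) by (intro sum_mono) (simp add: add_pos_nonneg)
  then have "concord A (X + D) \<le> concord A X"
    using quad_part_add_kernel[of A D X] assms(1) D(2) by (simp add: concord_eq psd_mat_def)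
  moreover have "X + D \<in> graph_mats_pos_diag E"
    using graph_mats_add[OF mem D(1)] pos D(3)
    by (simp add: graph_mats_pos_diag_def add_pos_nonneg)
  ultimately have "is_arg_min (concord A) (\<lambda>\<Omega>. \<Omega> \<in> graph_mats_pos_diag E) (X + D)"
    using X by (fastforce simp: is_arg_min_def)
  then show "D = 0" using uniq by fastforce
qed

lemma concord_unique_minimizer_iff:
  assumes "psd_mat A"
  shows "concord_unique_minimizer E A \<longleftrightarrow> no_recession E A"
  using unique_minimizer_no_recession[OF assms] minimizer_exists[OF assms]
    minimizer_unique[OF assms] unfolding concord_unique_minimizer_def by blast

text \<open>The passage through the criterion matters: a minimizer for \<open>E2\<close> may lie
  outside the space of \<open>E1\<close>, whereas directions for \<open>E1\<close> are also
  directions for \<open>E2\<close>.\<close>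

lemma concord_unique_minimizer_antimono:
  assumes "psd_mat A" and "E1 \<subseteq> E2" and "concord_unique_minimizer E2 A"
  shows "concord_unique_minimizer E1 A"
proof -
  have "graph_mats E1 \<subseteq> graph_mats E2"
    using assms(2) by (auto simp: graph_mats_def)
  then show ?thesis
    using assms by (auto simp: concord_unique_minimizer_iff no_recession_def)
qed

section \<open>Monotonicity of the two ranks\<close>

text \<open>The form at \<open>x\<close> is the sum of the squared inner products of
  \<open>x\<close> with the rows.\<close>

lemma psd_mat_gram: "psd_mat (gram r X)"
proof -
  have "x \<bullet> (gram r X *v x) = (\<Sum>i<r. (X i \<bullet> x)\<^sup>2)" for x
  proof -
    have "x \<bullet> (gram r X *v x) = (\<Sum>j\<in>UNIV. \<Sum>k\<in>UNIV. \<Sum>i<r. (X i $ j * x $ j) * (X i $ k * x $ k))"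
      by (simp add: inner_vec_def matrix_vector_mult_def gram_def sum_distrib_left
          sum_distrib_right mult_ac)
    also have "\<dots> = (\<Sum>j\<in>UNIV. \<Sum>i<r. \<Sum>k\<in>UNIV. (X i $ j * x $ j) * (X i $ k * x $ k))"
      by (intro sum.cong refl sum.swap)
    also have "\<dots> = (\<Sum>i<r. \<Sum>j\<in>UNIV. \<Sum>k\<in>UNIV. (X i $ j * x $ j) * (X i $ k * x $ k))"
      by (rule sum.swap)
    also have "\<dots> = (\<Sum>i<r. (X i \<bullet> x)\<^sup>2)"
      by (simp add: inner_vec_def power2_eq_square sum_product)
    finally show ?thesis .
  qed
  then show ?thesis
    by (auto simp: psd_mat_def sym_mat_nth gram_def mult.commute intro: sum_nonneg)
qed

lemma weak_pl_rank_mono: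
  fixes E1 E2 :: "'n::finite set set"
  assumes "E1 \<subseteq> E2"
  shows "weak_pl_rank E1 \<le> weak_pl_rank E2"
proof -
  let ?P = "\<lambda>E \<rho>. almost_every_psd_rank_ge \<rho> (concord_unique_minimizer E)"
  \<comment> \<open>No \<open>r\<close> lies between p + 1 and p, so this value is vacuously
    admissible and the least one exists.\<close>
  have "?P E2 (Suc (CARD('n)))"
    by (auto simp: almost_every_psd_rank_ge_def)
  then have "?P E2 (weak_pl_rank E2)"
    unfolding weak_pl_rank_def by (rule LeastI)
  then have "?P E1 (weak_pl_rank E2)"
    unfolding almost_every_psd_rank_ge_def
    using concord_unique_minimizer_antimono[OF psd_mat_gram assms]
    by (auto intro: eventually_mono)
  then show ?thesis
    unfolding weak_pl_rank_def[of E1] by (rule Least_le)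
qed

lemma strong_pl_rank_mono:
  fixes E1 E2 :: "'n::finite set set"
  assumes "E1 \<subseteq> E2"
  shows "strong_pl_rank E1 \<le> strong_pl_rank E2"
proof -
  let ?P = "\<lambda>E \<rho>. \<forall>A. psd_mat A \<and> general_position A \<and> rank A \<ge> \<rho>
     \<longrightarrow> concord_unique_minimizer E A"
  \<comment> \<open>Again p + 1 is vacuously admissible, here because no rank exceeds p.\<close>
  have "rank A < Suc (CARD('n))" for A :: "real^'n^'n"
    using rank_bound[of A] by simp
  then have "?P E2 (Suc (CARD('n)))"
    using leD by blast
  then have "?P E2 (strong_pl_rank E2)"
    unfolding strong_pl_rank_def by (rule LeastI)
  then have "?P E1 (strong_pl_rank E2)"
    using concord_unique_minimizer_antimono[OF _ assms] by blast
  then show ?thesis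
    unfolding strong_pl_rank_def[of E1] by (rule Least_le)
qed

theorem corollary1:
  fixes E1 E2 :: "'n::finite set set"
  assumes "graph_edges E1" and "graph_edges E2"
    and "E1 \<subseteq> E2"
  shows "weak_pl_rank E1 \<le> weak_pl_rank E2 \<and> strong_pl_rank E1 \<le> strong_pl_rank E2"
  using weak_pl_rank_mono strong_pl_rank_mono assms(3) by blast

end
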